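(* Let $X = D \cup S$ be a non-empty set of defeasible sentences ($D$) and strict sentences ($S$) built from formulas of $\mathcal{F}$. Then $X$ is p-consistent if and only if every non-empty subset of $X$ is confirmable.
   Context: $\mathcal{F}$ is the set of propositional formulas over a fixed finite set of propositional variables. A defeasible sentence is an expression $\phi \rightarrow \psi$ and a strict sentence is an expression $\phi \Rightarrow \psi$, with $\phi,\psi \in \mathcal{F}$; the connectives $\rightarrow$ and $\Rightarrow$ occur only as main connectives (the two kinds of sentences are formally distinct). A conditional sentence is a sentence of either kind, with antecedent $\phi$ and consequent $\psi$; its material counterpart is the formula $\phi \supset \psi$ (material implication). Truth assignments: a truth assignment $t$ maps formulas to $\{0,1\}$ respecting the boolean connectives. A conditional sentence with antecedent $\phi$ and consequent $\psi$ is verified by $t$ if $t(\phi)=t(\psi)=1$, falsified by $t$ if $t(\phi)=1$ and $t(\psi)=0$, and otherwise neither. Probability assignments: let $P$ be a probability distribution on the (finite) set of truth assignments. For a conditional sentence $x$ (defeasible or strict) with antecedent $\phi$ and consequent $\psi$, $$P(x) = \frac{\sum_t P(t)\, t(\phi\wedge\psi)}{\sum_t P(t)\, t(\phi)}.$$ $P$ is proper for a set of sentences if this denominator is non-zero for each sentence of the set. p-consistency: $X = D\cup S$ is p-consistent if for every $\varepsilon>0$ there is a $P$ proper for $X$ with $P(d)\ge 1-\varepsilon$ for all $d\in D$ and $P(s)=1$ for all $s\in S$. Tolerance: a conditional sentence $x$ is tolerated by a set $Y$ of conditional sentences if some truth assignment verifies $x$ and falsifies no sentence of $Y$; equivalently,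 if $x$ has antecedent $\phi$ and consequent $\psi$, the formula $\phi\wedge\psi$ together with the material counterparts of all sentences of $Y$ is satisfiable. Confirmability: a non-empty set $X'=D'\cup S'$ ($D'$ defeasible, $S'$ strict) is confirmable if: (1) when $D'$ is non-empty, at least one $d\in D'$ is tolerated by the rest of the sentences of $X'$; (2) when $D'$ is empty, each $s\in S'$ is tolerated by the rest of the sentences of $S'$. *)

theory Defs
  imports "HOL-Probability.Probability_Mass_Function"
begin

datatype 'v formula =
    Atom 'v
  | Neg "'v formula"
  | And "'v formula" "'v formula"
  | Or "'v formula" "'v formula"
  | Imp "'v formula" "'v formula"

text \<open>A truth assignment is determined by its values on the propositional variables and is
  represented by them; \<open>eval\<close> is its unique extension to formulas that respects the connectives.\<close>

type_synonym 'v assignment = "'v \<Rightarrow> bool"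

primrec eval :: "'v assignment \<Rightarrow> 'v formula \<Rightarrow> bool" where
  "eval t (Atom p) \<longleftrightarrow> t p"
| "eval t (Neg \<phi>) \<longleftrightarrow> \<not> eval t \<phi>"
| "eval t (And \<phi> \<psi>) \<longleftrightarrow> eval t \<phi> \<and> eval t \<psi>"
| "eval t (Or \<phi> \<psi>) \<longleftrightarrow> eval t \<phi> \<or> eval t \<psi>"
| "eval t (Imp \<phi> \<psi>) \<longleftrightarrow> (eval t \<phi> \<longrightarrow> eval t \<psi>)"

datatype 'v sentence =
    is_defeasible: Defeasible (antecedent: "'v formula") (consequent: "'v formula")
  | is_strict: Strict (antecedent: "'v formula") (consequent: "'v formula")

definition defeasible_part :: "'v sentence set \<Rightarrow> 'v sentence set" where
  "defeasible_part X = {x \<in> X. is_defeasible x}"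

definition strict_part :: "'v sentence set \<Rightarrow> 'v sentence set" where
  "strict_part X = {x \<in> X. is_strict x}"

definition verifies :: "'v assignment \<Rightarrow> 'v sentence \<Rightarrow> bool" where
  "verifies t x \<longleftrightarrow> eval t (antecedent x) \<and> eval t (consequent x)"

definition falsifies :: "'v assignment \<Rightarrow> 'v sentence \<Rightarrow> bool" where
  "falsifies t x \<longleftrightarrow> eval t (antecedent x) \<and> \<not> eval t (consequent x)"

definition formula_prob :: "'v::finite assignment pmf \<Rightarrow> 'v formula \<Rightarrow> real" where
  "formula_prob P \<phi> = (\<Sum>t\<in>UNIV. pmf P t * of_bool (eval t \<phi>))"

definition sentence_prob :: "'v::finite assignment pmf \<Rightarrow> 'v sentence \<Rightarrow> real" where
  "sentence_prob P x =
     formula_prob P (And (antecedent x) (consequent x)) / formula_prob P (antecedent x)"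

definition proper :: "'v::finite assignment pmf \<Rightarrow> 'v sentence set \<Rightarrow> bool" where
  "proper P X \<longleftrightarrow> (\<forall>x\<in>X. formula_prob P (antecedent x) \<noteq> 0)"

definition p_consistent :: "'v::finite sentence set \<Rightarrow> bool" where
  "p_consistent X \<longleftrightarrow>
     (\<forall>\<epsilon>>0. \<exists>P. proper P X \<and>
        (\<forall>d\<in>defeasible_part X. sentence_prob P d \<ge> 1 - \<epsilon>) \<and>
        (\<forall>s\<in>strict_part X. sentence_prob P s = 1))"

definition tolerated :: "'v sentence \<Rightarrow> 'v sentence set \<Rightarrow> bool" where
  "tolerated x Y \<longleftrightarrow> (\<exists>t. verifies t x \<and> (\<forall>y\<in>Y. \<not> falsifies t y))"

definition confirmable :: "'v sentence set \<Rightarrow> bool" where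
  "confirmable X \<longleftrightarrow> X \<noteq> {} \<and>
     (defeasible_part X \<noteq> {} \<longrightarrow> (\<exists>d\<in>defeasible_part X. tolerated d (X - {d}))) \<and>
     (defeasible_part X = {} \<longrightarrow> (\<forall>s\<in>strict_part X. tolerated s (strict_part X - {s})))"

end

(* Left to right, with N assignments and epsilon < 1/N: a most probable assignment t among those
   satisfying the antecedent of some defeasible sentence of X' falsifies none of these sentences,
   since falsifying d would give P(t) <= epsilon * P(antecedent of d) <= epsilon * N * P(t).
   Right to left: give weights to assignments so that every falsifier of a defeasible sentence is
   outweighed by a factor eta by some verifier, and no assignment of positive weight falsifies a
   strict sentence.  Among such weights choose one with the largest support.  If some antecedent had
   weight 0, confirmability of the strict sentences together with the defeasible ones whose
   antecedent has weight 0 would yield an assignment that can be added to the support with a tiny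
   weight.  The normalised weight is the required distribution.  As the argument counts assignments
   and not sentences, it also applies to infinite X. *)
theory Submission
  imports Defs
begin

section \<open>Masses of formulas and of falsifiers\<close>

definition falsity_prob :: "'v::finite assignment pmf \<Rightarrow> 'v sentence \<Rightarrow> real" where
  "falsity_prob P x = formula_prob P (And (antecedent x) (Neg (consequent x)))"

lemma formula_prob_nonneg: "formula_prob P \<phi> \<ge> 0"
  unfolding formula_prob_def by (intro sum_nonneg) simp

lemma pmf_le_formula_prob:
  assumes "eval t \<phi>"
  shows "pmf P t \<le> formula_prob P \<phi>"
proof -
  have "pmf P t * of_bool (eval t \<phi>) \<le> formula_prob P \<phi>"
    unfolding formula_prob_def by (intro member_le_sum) auto
  with assms show ?thesis by simp
qed

text \<open>This crude bound is the source of the factor \<open>N\<close> in both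
  directions.\<close>

lemma formula_prob_le_card:
  fixes P :: "'v::finite assignment pmf"
  assumes "\<And>t. eval t \<phi> \<Longrightarrow> pmf P t \<le> m" and "0 \<le> m"
  shows "formula_prob P \<phi> \<le> real CARD('v assignment) * m"
  unfolding formula_prob_def using assms by (intro sum_bounded_above) auto

lemma formula_prob_pos_iff: "formula_prob P \<phi> > 0 \<longleftrightarrow> (\<exists>t. eval t \<phi> \<and> pmf P t > 0)"
proof
  assume "formula_prob P \<phi> > 0"
  then have "(\<Sum>t\<in>UNIV. pmf P t * of_bool (eval t \<phi>)) \<noteq> 0"
    by (simp add: formula_prob_def)
  then obtain t where "pmf P t * of_bool (eval t \<phi>) \<noteq> 0"
    by (rule sum.not_neutral_contains_not_neutral)
  then show "\<exists>t. eval t \<phi> \<and> pmf P t > 0"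
    by (auto simp: pmf_positive set_pmf_iff)
next
  assume "\<exists>t. eval t \<phi> \<and> pmf P t > 0"
  then show "formula_prob P \<phi> > 0"
    using pmf_le_formula_prob by (metis less_le_trans)
qed

lemma formula_prob_antecedent:
  "formula_prob P (antecedent x) =
     formula_prob P (And (antecedent x) (consequent x)) + falsity_prob P x"
  unfolding formula_prob_def falsity_prob_def
  by (subst sum.distrib[symmetric], rule sum.cong) auto

text \<open>Verified and falsified mass add up to the mass of the antecedent, so clearing the
  positive denominator leaves a linear bound on the falsified mass.\<close>

lemma sentence_prob_ge_iff:
  assumes "formula_prob P (antecedent x) \<noteq> 0"
  shows "sentence_prob P x \<ge> 1 - \<epsilon> \<longleftrightarrow>
           falsity_prob P x \<le> \<epsilon> * formula_prob P (antecedent x)"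
proof -
  have "formula_prob P (antecedent x) > 0"
    using assms formula_prob_nonneg by (metis less_eq_real_def)
  then show ?thesis
    using formula_prob_antecedent[of P x]
    unfolding sentence_prob_def by (auto simp: field_simps)
qed

text \<open>The falsified mass is a sum of nonnegative terms and vanishes only termwise; so a strict
  sentence of probability 1 constrains just the support of \<open>P\<close>.\<close>

lemma sentence_prob_eq_1_iff:
  assumes "formula_prob P (antecedent x) \<noteq> 0"
  shows "sentence_prob P x = 1 \<longleftrightarrow> (\<forall>t. falsifies t x \<longrightarrow> pmf P t = 0)"
proof -
  have "sentence_prob P x = 1 \<longleftrightarrow> falsity_prob P x = 0"
    using assms formula_prob_antecedent[of P x]
    unfolding sentence_prob_def by (auto simp: field_simps)
  also have "\<dots> \<longleftrightarrow> \<not> falsity_prob P x > 0"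
    using formula_prob_nonneg unfolding falsity_prob_def by (metis less_eq_real_def less_irrefl)
  also have "\<dots> \<longleftrightarrow> (\<forall>t. falsifies t x \<longrightarrow> pmf P t = 0)"
    unfolding falsity_prob_def formula_prob_pos_iff
    by (auto simp: falsifies_def pmf_positive_iff set_pmf_iff)
  finally show ?thesis .
qed

section \<open>From p-consistency to confirmability\<close>

lemma p_consistent_imp_confirmable:
  fixes X :: "'v::finite sentence set"
  assumes "p_consistent X" and "X' \<subseteq> X" and "X' \<noteq> {}"
  shows "confirmable X'"
proof -
  define N where "N = real CARD('v assignment)"
  \<comment> \<open>With this choice of \<epsilon>, \<open>N\<close> times \<epsilon> stays strictly
    below 1.\<close>
  have "1 / (N + 1) > 0"
    by (simp add: N_def add_nonneg_pos)
  with assms(1) obtain P where P: "proper P X"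
    "\<And>d. d \<in> defeasible_part X \<Longrightarrow> sentence_prob P d \<ge> 1 - 1 / (N + 1)"
    "\<And>s. s \<in> strict_part X \<Longrightarrow> sentence_prob P s = 1"
    unfolding p_consistent_def by blast
  have nz: "formula_prob P (antecedent x) \<noteq> 0" if "x \<in> X'" for x
    using P(1) that assms(2) unfolding proper_def by blast
  have live: "\<exists>t. eval t (antecedent x) \<and> pmf P t > 0" if "x \<in> X'" for x
    using nz[OF that] formula_prob_nonneg formula_prob_pos_iff by (metis less_eq_real_def)
  have strict: "pmf P t = 0" if "s \<in> strict_part X'" "falsifies t s" for s t
  proof -
    have "s \<in> strict_part X" "s \<in> X'"
      using that(1) assms(2) by (auto simp: strict_part_def)
    then show ?thesis
      using P(3) sentence_prob_eq_1_iff[OF nz] that(2) by blast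
  qed
  have "\<exists>d\<in>defeasible_part X'. tolerated d (X' - {d})" if ne: "defeasible_part X' \<noteq> {}"
  proof -
    \<comment> \<open>\<open>T\<close> collects the antecedents of all defeasible sentences of
      \<open>X'\<close> at once, so that a single maximiser can be compared with each of
      them.\<close>
    define T where "T = {t. \<exists>d\<in>defeasible_part X'. eval t (antecedent d)}"
    obtain d0 where "d0 \<in> defeasible_part X'"
      using ne by blast
    then obtain t0 where t0: "t0 \<in> T" "pmf P t0 > 0"
      using live[of d0] by (auto simp: T_def defeasible_part_def)
    have "finite (pmf P ` T)" "pmf P ` T \<noteq> {}"
      using t0 by auto
    then have "Max (pmf P ` T) \<in> pmf P ` T" and mx: "\<forall>u\<in>T. pmf P u \<le> Max (pmf P ` T)"
      by (auto intro!: Max_in)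
    then obtain t where t: "t \<in> T" "\<And>u. u \<in> T \<Longrightarrow> pmf P u \<le> pmf P t"
      by (metis imageE)
    have pos: "pmf P t > 0"
      using t(2)[OF t0(1)] t0(2) by simp
    have not_def: "\<not> falsifies t d" if d: "d \<in> defeasible_part X'" for d
    proof
      assume "falsifies t d"
      then have "pmf P t \<le> falsity_prob P d"
        unfolding falsity_prob_def by (intro pmf_le_formula_prob) (simp add: falsifies_def)
      also have "\<dots> \<le> 1 / (N + 1) * formula_prob P (antecedent d)"
      proof -
        have "d \<in> X'" "d \<in> defeasible_part X"
          using d assms(2) by (auto simp: defeasible_part_def)
        then show ?thesis
          using P(2) sentence_prob_ge_iff[OF nz] by blast
      qed
      \<comment> \<open>Every assignment satisfying the antecedent of \<open>d\<close> lies in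
        \<open>T\<close>, so none is more probable than \<open>t\<close>.\<close>
      also have "\<dots> \<le> 1 / (N + 1) * (N * pmf P t)"
        unfolding N_def using d t(2)
        by (intro mult_left_mono formula_prob_le_card) (auto simp: T_def)
      also have "\<dots> < pmf P t"
        using pos by (simp add: N_def field_simps add_nonneg_pos)
      finally show False by simp
    qed
    \<comment> \<open>The tolerated sentence is one that put \<open>t\<close> into \<open>T\<close>;
      it may differ from \<open>d0\<close>.\<close>
    obtain d where d: "d \<in> defeasible_part X'" "eval t (antecedent d)"
      using t(1) by (auto simp: T_def)
    have "verifies t d"
      using not_def[OF d(1)] d(2) by (auto simp: verifies_def falsifies_def)
    moreover have "\<not> falsifies t y" if "y \<in> X'" for y
    proof (cases "is_defeasible y")
      case True
      then show ?thesis using not_def that by (simp add: defeasible_part_def)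
    next
      case False
      then have "y \<in> strict_part X'"
        using that by (cases y) (auto simp: strict_part_def)
      then show ?thesis using strict pos by force
    qed
    ultimately show ?thesis
      using d(1) unfolding tolerated_def by blast
  qed
  \<comment> \<open>An assignment of positive probability falsifies no strict sentence,
    \<open>s\<close> included; so satisfying the antecedent of \<open>s\<close> means verifying
    \<open>s\<close>.\<close>
  moreover have "tolerated s (strict_part X' - {s})" if s: "s \<in> strict_part X'" for s
  proof -
    obtain t where t: "eval t (antecedent s)" "pmf P t > 0"
      using live[of s] s by (auto simp: strict_part_def)
    then have *: "\<not> falsifies t y" if "y \<in> strict_part X'" for y
      using strict[OF that] by force
    then have "verifies t s"
      using t(1) s by (auto simp: verifies_def falsifies_def)
    then show ?thesis
      using * unfolding tolerated_def by blast
  qed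
  ultimately show ?thesis
    using assms(3) unfolding confirmable_def by blast
qed

section \<open>Weights under which falsifiers are dominated by verifiers\<close>

definition dominating :: "real \<Rightarrow> 'v sentence set \<Rightarrow> ('v assignment \<Rightarrow> real) \<Rightarrow> bool" where
  "dominating \<eta> X w \<longleftrightarrow> (\<forall>t. w t \<ge> 0) \<and>
     (\<forall>s\<in>strict_part X. \<forall>t. falsifies t s \<longrightarrow> w t = 0) \<and>
     (\<forall>d\<in>defeasible_part X. \<forall>u. falsifies u d \<and> w u > 0 \<longrightarrow>
        (\<exists>v. verifies v d \<and> w v > 0 \<and> w u \<le> \<eta> * w v))"

text \<open>Domination compares single assignments, not sums, so adding a new assignment disturbs no
  existing comparison. Only the sentences that the new one falsifies need care, and a small weight
  settles these.\<close>

lemma dominating_extend: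
  fixes X :: "'v::finite sentence set"
  assumes conf: "\<forall>X'\<subseteq>X. X' \<noteq> {} \<longrightarrow> confirmable X'"
    and "\<eta> > 0" and dom: "dominating \<eta> X w"
    and x: "x \<in> X" "\<forall>t. eval t (antecedent x) \<longrightarrow> w t = 0"
  shows "\<exists>w'. dominating \<eta> X w' \<and> {t. w t > 0} \<subset> {t. w' t > 0}"
proof -
  let ?dead = "\<lambda>x. \<forall>t. eval t (antecedent x) \<longrightarrow> w t = 0"
  \<comment> \<open>All strict sentences are kept, so that the new assignment falsifies none of
    them; the defeasible ones are restricted to \<open>?dead\<close>, so that a verifier of one has
    weight 0 so far.\<close>
  define X' where "X' = {d \<in> defeasible_part X. ?dead d} \<union> strict_part X"
  have "x \<in> X'"
    using x by (cases x) (auto simp: X'_def defeasible_part_def strict_part_def)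
  moreover have "X' \<subseteq> X"
    by (auto simp: X'_def defeasible_part_def strict_part_def)
  ultimately have cX': "confirmable X'"
    using conf by blast
  have strict_X': "strict_part X' = strict_part X"
    and def_X': "defeasible_part X' = {d \<in> defeasible_part X. ?dead d}"
    by (auto simp: X'_def strict_part_def defeasible_part_def sentence.disc_eq_case
        split: sentence.splits)
  \<comment> \<open>A tolerated defeasible sentence of \<open>X'\<close> is dead by construction. If
    there is none, every strict sentence is tolerated, in particular the dead \<open>x\<close>.
    Verifying \<open>y\<close> also excludes falsifying it, so all of \<open>X'\<close> is
    covered.\<close>
  obtain y t where t: "?dead y" "verifies t y" "\<And>z. z \<in> X' \<Longrightarrow> \<not> falsifies t z"
  proof (cases "defeasible_part X' = {}")
    case False
    then obtain d u where "d \<in> defeasible_part X'" "verifies u d" "\<forall>z\<in>X' - {d}. \<not> falsifies u z"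
      using cX' unfolding confirmable_def tolerated_def by blast
    then show thesis
      using that[of d u] unfolding def_X' by (auto simp: verifies_def falsifies_def)
  next
    case True
    then have "X' = strict_part X'"
      unfolding strict_X' def_X' by (auto simp: X'_def)
    then obtain u where "verifies u x" "\<forall>z\<in>X' - {x}. \<not> falsifies u z"
      using True cX' \<open>x \<in> X'\<close> unfolding confirmable_def tolerated_def by metis
    then show thesis
      using that[of x u] x(2) by (auto simp: verifies_def falsifies_def)
  qed
  have wt: "w t = 0"
    using t(1,2) by (auto simp: verifies_def)
  \<comment> \<open>The element 1 keeps the set non-empty while \<open>w\<close> is still zero
    everywhere.\<close>
  define m where "m = Min (insert 1 ((\<lambda>v. \<eta> * w v) ` {v. w v > 0}))"
  have m: "m > 0" "\<And>v. w v > 0 \<Longrightarrow> m \<le> \<eta> * w v"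
    unfolding m_def using \<open>\<eta> > 0\<close> by auto
  define w' where "w' = w(t := m)"
  have w'_eq: "w' v = w v" if "w v > 0" for v
    using that wt by (auto simp: w'_def)
  have "dominating \<eta> X w'"
    unfolding dominating_def
  proof (intro conjI allI ballI impI; (elim conjE)?)
    fix u show "w' u \<ge> 0"
      using dom m(1) by (simp add: w'_def dominating_def)
  next
    fix s u assume "s \<in> strict_part X" "falsifies u s"
    then show "w' u = 0"
      using dom t(3)[of s] by (auto simp: w'_def dominating_def X'_def)
  next
    fix d u assume d: "d \<in> defeasible_part X" "falsifies u d" "w' u > 0"
    have ver: "\<exists>v. verifies v d \<and> w v > 0 \<and> w u \<le> \<eta> * w v" if "falsifies u d" "w u > 0" for u
      using dom d(1) that by (simp add: dominating_def)
    have "\<exists>v. verifies v d \<and> w v > 0 \<and> w' u \<le> \<eta> * w v"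
    proof (cases "u = t")
      case False
      then show ?thesis
        using d ver by (simp add: w'_def)
    next
      case True
      \<comment> \<open>Since \<open>t\<close> falsifies nothing in \<open>X'\<close>, the sentence
        \<open>d\<close> lies outside \<open>X'\<close>.\<close>
      then have "\<not> ?dead d"
        using d(1,2) t(3)[of d] by (auto simp: X'_def)
      then obtain v where "eval v (antecedent d)" "w v > 0"
        using dom by (auto simp: dominating_def less_le)
      \<comment> \<open>Either \<open>v\<close> verifies \<open>d\<close> itself, or it falsifies
        \<open>d\<close> and domination under \<open>w\<close> supplies a verifier.\<close>
      then obtain v' where "verifies v' d" "w v' > 0"
        using ver[of v] by (auto simp: verifies_def falsifies_def)
      then show ?thesis
        using True m(2) by (auto simp: w'_def)
    qed
    then show "\<exists>v. verifies v d \<and> w' v > 0 \<and> w' u \<le> \<eta> * w' v"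
      using w'_eq by metis
  qed
  moreover have "{t. w t > 0} \<subset> {t. w' t > 0}"
  proof (rule psubsetI)
    show "{t. w t > 0} \<subseteq> {t. w' t > 0}"
      using w'_eq by auto
    have "w' t > 0" "\<not> w t > 0"
      using wt m(1) by (simp_all add: w'_def)
    then show "{t. w t > 0} \<noteq> {t. w' t > 0}"
      by blast
  qed
  ultimately show ?thesis by blast
qed

text \<open>Finitely many assignments bound the support, so a largest one exists among dominating
  weights, and \<open>dominating_extend\<close> rules out a dead antecedent there.\<close>

lemma ex_dominating_live:
  fixes X :: "'v::finite sentence set"
  assumes "\<forall>X'\<subseteq>X. X' \<noteq> {} \<longrightarrow> confirmable X'" and "\<eta> > 0"
  shows "\<exists>w. dominating \<eta> X w \<and> (\<forall>x\<in>X. \<exists>t. eval t (antecedent x) \<and> w t > 0)"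
proof -
  have "dominating \<eta> X (\<lambda>_. 0)"
    by (simp add: dominating_def)
  \<comment> \<open>The support may consist of all assignments, hence \<open>Suc\<close> in the
    strict bound.\<close>
  moreover have "\<forall>w. dominating \<eta> X w \<longrightarrow> card {t. w t > 0} < Suc CARD('v assignment)"
    by (simp add: card_mono le_imp_less_Suc)
  ultimately obtain w where w: "dominating \<eta> X w"
    "\<forall>w'. dominating \<eta> X w' \<longrightarrow> card {t. w' t > 0} \<le> card {t. w t > 0}"
    using ex_has_greatest_nat[where P = "dominating \<eta> X" and f = "\<lambda>w. card {t. w t > 0}"]
    by blast
  have "\<exists>t. eval t (antecedent x) \<and> w t > 0" if x: "x \<in> X" for x
  proof (rule ccontr)
    assume "\<not> ?thesis"
    then have "\<forall>t. eval t (antecedent x) \<longrightarrow> w t = 0"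
      using w(1) by (auto simp: dominating_def less_le)
    then obtain w' where "dominating \<eta> X w'" "{t. w t > 0} \<subset> {t. w' t > 0}"
      using dominating_extend[OF assms w(1) x] by blast
    then show False
      using w(2) psubset_card_mono[of "{t. w' t > 0}" "{t. w t > 0}"] by force
  qed
  with w(1) show ?thesis by blast
qed

text \<open>Dividing by the total weight; domination is invariant under scaling, so it passes to
  \<open>P\<close> through the factor \<open>c\<close>.\<close>

lemma ex_pmf_proportional:
  fixes w :: "'a::finite \<Rightarrow> real"
  assumes "\<And>t. w t \<ge> 0" and "w t0 > 0"
  shows "\<exists>P c. c > 0 \<and> (\<forall>t. pmf P t = c * w t)"
proof -
  define c where "c = 1 / sum w UNIV"
  have pos: "sum w UNIV > 0"
    using assms by (intro sum_pos2[of _ t0]) auto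
  have nn: "c * w t \<ge> 0" for t
    using assms(1) pos by (simp add: c_def)
  have "(\<integral>\<^sup>+t. ennreal (c * w t) \<partial>count_space UNIV) = ennreal (\<Sum>t\<in>UNIV. c * w t)"
    using nn by (simp add: nn_integral_count_space_finite sum_ennreal)
  also have "(\<Sum>t\<in>UNIV. c * w t) = 1"
    using pos by (simp add: c_def sum_divide_distrib[symmetric])
  finally have "pmf (embed_pmf (\<lambda>t. c * w t)) t = c * w t" for t
    using nn by (intro pmf_embed_pmf) auto
  moreover have "c > 0"
    using pos by (simp add: c_def)
  ultimately show ?thesis by blast
qed

section \<open>From confirmability to p-consistency\<close>

lemma confirmable_imp_p_consistent:
  fixes X :: "'v::finite sentence set"
  assumes conf: "\<forall>X'\<subseteq>X. X' \<noteq> {} \<longrightarrow> confirmable X'" and "X \<noteq> {}"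
  shows "p_consistent X"
  unfolding p_consistent_def
proof (intro allI impI)
  fix \<epsilon> :: real assume "\<epsilon> > 0"
  define N where "N = real CARD('v assignment)"
  have "N > 0"
    by (simp add: N_def)
  \<comment> \<open>At most \<open>N\<close> falsifiers, each of mass at most
    \<open>\<epsilon> / N\<close> times that of the antecedent, together stay within \<epsilon>
    times it.\<close>
  then have "\<epsilon> / N > 0"
    using \<open>\<epsilon> > 0\<close> by simp
  from ex_dominating_live[OF conf this] obtain w where w: "dominating (\<epsilon> / N) X w"
    and live: "\<And>x. x \<in> X \<Longrightarrow> \<exists>t. eval t (antecedent x) \<and> w t > 0"
    by blast
  \<comment> \<open>A live antecedent of some sentence of \<open>X\<close> makes the total weight
    positive, so that it can be normalised.\<close>
  have "\<exists>t0. w t0 > 0"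
    using live \<open>X \<noteq> {}\<close> by blast
  then obtain P c where "c > 0" and P: "\<And>t. pmf P t = c * w t"
    using ex_pmf_proportional[of w] w unfolding dominating_def by blast
  have nz: "formula_prob P (antecedent x) \<noteq> 0" if "x \<in> X" for x
  proof -
    have "\<exists>t. eval t (antecedent x) \<and> pmf P t > 0"
      unfolding P using live[OF that] \<open>c > 0\<close> by (simp add: zero_less_mult_iff)
    then show ?thesis
      unfolding formula_prob_pos_iff[symmetric] by simp
  qed
  have "sentence_prob P d \<ge> 1 - \<epsilon>" if d: "d \<in> defeasible_part X" for d
  proof -
    let ?A = "formula_prob P (antecedent d)"
    have "pmf P u \<le> \<epsilon> / N * ?A" if u: "falsifies u d" for u
    proof (cases "w u > 0")
      case True
      then obtain v where v: "verifies v d" "w u \<le> \<epsilon> / N * w v"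
        using w d u unfolding dominating_def by blast
      have "pmf P u \<le> \<epsilon> / N * pmf P v"
        using mult_left_mono[OF v(2), of c] \<open>c > 0\<close> by (simp add: P mult_ac)
      \<comment> \<open>The verifier \<open>v\<close> satisfies the antecedent, so its mass is part
        of \<open>?A\<close>.\<close>
      also have "\<dots> \<le> \<epsilon> / N * ?A"
        using v(1) \<open>\<epsilon> / N > 0\<close>
        by (intro mult_left_mono pmf_le_formula_prob) (auto simp: verifies_def)
      finally show ?thesis .
    next
      case False
      then have "pmf P u \<le> 0"
        using \<open>c > 0\<close> by (simp add: P mult_nonneg_nonpos)
      also have "0 \<le> \<epsilon> / N * ?A"
        using \<open>\<epsilon> / N > 0\<close> formula_prob_nonneg by (metis less_imp_le mult_nonneg_nonneg)
      finally show ?thesis .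
    qed
    moreover have "0 \<le> \<epsilon> / N * ?A"
      using \<open>\<epsilon> / N > 0\<close> formula_prob_nonneg by (metis less_imp_le mult_nonneg_nonneg)
    ultimately have "falsity_prob P d \<le> N * (\<epsilon> / N * ?A)"
      unfolding falsity_prob_def N_def
      by (intro formula_prob_le_card) (auto simp: falsifies_def)
    also have "\<dots> = \<epsilon> * ?A"
      using \<open>N > 0\<close> by simp
    finally show ?thesis
      using d sentence_prob_ge_iff[OF nz] by (simp add: defeasible_part_def)
  qed
  moreover have "sentence_prob P s = 1" if s: "s \<in> strict_part X" for s
  proof -
    have "\<forall>t. falsifies t s \<longrightarrow> pmf P t = 0"
      using w s by (simp add: P dominating_def)
    then show ?thesis
      using s sentence_prob_eq_1_iff[OF nz] by (simp add: strict_part_def)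
  qed
  ultimately show "\<exists>P. proper P X \<and> (\<forall>d\<in>defeasible_part X. sentence_prob P d \<ge> 1 - \<epsilon>) \<and>
      (\<forall>s\<in>strict_part X. sentence_prob P s = 1)"
    using nz unfolding proper_def by blast
qed

theorem theorem1:
  fixes X D S :: "'v::finite sentence set"
  assumes "\<forall>d\<in>D. is_defeasible d"
    and "\<forall>s\<in>S. is_strict s"
    and "X = D \<union> S"
    and "X \<noteq> {}"
  shows "p_consistent X \<longleftrightarrow> (\<forall>X'\<subseteq>X. X' \<noteq> {} \<longrightarrow> confirmable X')"
proof
  assume "p_consistent X"
  then show "\<forall>X'\<subseteq>X. X' \<noteq> {} \<longrightarrow> confirmable X'"
    by (intro allI impI) (rule p_consistent_imp_confirmable)
next
  assume "\<forall>X'\<subseteq>X. X' \<noteq> {} \<longrightarrow> confirmable X'"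
  then show "p_consistent X"
    using assms(4) by (rule confirmable_imp_p_consistent)
qed

end
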